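(* Let $P:\mathcal{C}^{\mathrm{op}}\to\mathbf{Pos}$ be a Skolem doctrine. Then $P$ validates the Skolemisation principle: for all objects $A,B,C$ of $\mathcal{C}$ and every predicate $\alpha\in P(A\times B\times C)$, $$a:A \mid \forall b:B.\,\exists c:C.\,\alpha(a,b,c)\ \dashv\vdash\ \exists f:C^B.\,\forall b:B.\,\alpha(a,b,\mathrm{ev}(f,b)),$$ where $\mathrm{ev}:C^B\times B\to C$ is the evaluation arrow of the cartesian closed category $\mathcal{C}$.
   Context: A doctrine is a functor $P:\mathcal{C}^{\mathrm{op}}\to\mathbf{Pos}$, where $\mathcal{C}$ has finite products and $\mathbf{Pos}$ is the category of posets and monotone maps. For $f:A\to B$ in $\mathcal{C}$ write $P_f:P(B)\to P(A)$. Elements of $P(A)$ are called predicates. $P$ is existential (resp. universal) if for every product projection $\pi_i:A_1\times A_2\to A_i$ the map $P_{\pi_i}$ has a left adjoint $\exists_{\pi_i}$ (resp. a right adjoint $\forall_{\pi_i}$) and the Beck-Chevalley condition holds: for every pullback square $\pi f'=f\pi'$ with $\pi:X\to A$ and $\pi':X'\to A'$ projections, $f:A'\to A$, $f':X'\to X$, and every $\beta\in P(X)$, $\exists_{\pi'}P_{f'}\beta=P_f\exists_\pi\beta$ (resp. $\forall_{\pi'}P_{f'}\beta=P_f\forall_\pi\beta$). Internal language: $a:A\mid\phi(a)\vdash\psi(a)$ means $\phi\le\psi$ in $P(A)$ (a context with several variables denotes the product of the types); $\dashv\vdash$ means both inequalities. For $\alpha\in P(A\times B)$, $\exists b:B.\,\alpha(a,b)$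 and $\forall b:B.\,\alpha(a,b)$ denote $\exists_{\pi_A}\alpha$ and $\forall_{\pi_A}\alpha$ in $P(A)$, with $\pi_A:A\times B\to A$ the projection. Terms are arrows of $\mathcal{C}$ and substitution is reindexing, e.g. $\alpha(a,g(a))$ is $P_{\langle 1_A,g\rangle}\alpha$. Let $P$ be existential. A predicate $\alpha\in P(A)$ is an existential splitting if for every object $B$ and every $\beta\in P(A\times B)$ with $\alpha(a)\vdash\exists b:B.\,\beta(a,b)$ there is an arrow $g:A\to B$ with $\alpha(a)\vdash\beta(a,g(a))$. A predicate $\alpha\in P(I)$ is existential-free if $P_f(\alpha)$ is an existential splitting for every arrow $f:A\to I$. $P$ has enough existential-free predicates if for every object $I$ and every $\alpha\in P(I)$ there are an object $A$ and an existential-free $\beta\in P(I\times A)$ with $\alpha=\exists_{\pi_I}\beta$. A doctrine $P:\mathcal{C}^{\mathrm{op}}\to\mathbf{Pos}$ is a Skolem doctrine if: (i) $\mathcal{C}$ is cartesian closed; (ii) $P$ is existential and universal; (iii) $P$ has enough existential-free predicates; (iv) if $\alpha\in P(A)$ is existential-free, then $\forall_\pi(\alpha)$ is existential-free for every projection $\pi$ from $A$. *)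

theory Defs
  imports "HOL-Algebra.Galois_Connection"
begin

section \<open>Cartesian closed categories\<close>

record ('o, 'a) category =
  Obj  :: "'o set"
  Arr  :: "'a set"
  Dom  :: "'a \<Rightarrow> 'o"
  Cod  :: "'a \<Rightarrow> 'o"
  Ide  :: "'o \<Rightarrow> 'a"
  Comp :: "'a \<Rightarrow> 'a \<Rightarrow> 'a"  (infixr \<open>\<cdot>\<index>\<close> 75)

definition Hom :: "('o, 'a, 'm) category_scheme \<Rightarrow> 'o \<Rightarrow> 'o \<Rightarrow> 'a set" where
  "Hom C A B = {f \<in> Arr C. Dom C f = A \<and> Cod C f = B}"

locale category =
  fixes C :: "('o, 'a, 'm) category_scheme" (structure)
  assumes Dom_Obj: "f \<in> Arr C \<Longrightarrow> Dom C f \<in> Obj C"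
    and Cod_Obj: "f \<in> Arr C \<Longrightarrow> Cod C f \<in> Obj C"
    and Ide_Hom: "A \<in> Obj C \<Longrightarrow> Ide C A \<in> Hom C A A"
    and Comp_Hom: "\<lbrakk>f \<in> Hom C A B; g \<in> Hom C B D\<rbrakk> \<Longrightarrow> g \<cdot> f \<in> Hom C A D"
    and Comp_Ide: "f \<in> Hom C A B \<Longrightarrow> f \<cdot> Ide C A = f"
    and Ide_Comp: "f \<in> Hom C A B \<Longrightarrow> Ide C B \<cdot> f = f"
    and Comp_assoc:
      "\<lbrakk>f \<in> Hom C A B; g \<in> Hom C B D; h \<in> Hom C D E\<rbrakk> \<Longrightarrow> (h \<cdot> g) \<cdot> f = h \<cdot> (g \<cdot> f)"

text \<open>Binary products (object and both projections) are chosen, as part of the structure; the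
  choice is only required to satisfy the universal property.\<close>

record ('o, 'a) fp_category = "('o, 'a) category" +
  Prod :: "'o \<Rightarrow> 'o \<Rightarrow> 'o"  (infixl \<open>\<otimes>\<index>\<close> 70)
  Fst  :: "'o \<Rightarrow> 'o \<Rightarrow> 'a"
  Snd  :: "'o \<Rightarrow> 'o \<Rightarrow> 'a"

locale fp_category = category C
  for C :: "('o, 'a, 'm) fp_category_scheme" (structure) +
  assumes terminal: "\<exists>T \<in> Obj C. \<forall>A \<in> Obj C. \<exists>!t. t \<in> Hom C A T"
    and Prod_Obj: "\<lbrakk>A \<in> Obj C; B \<in> Obj C\<rbrakk> \<Longrightarrow> A \<otimes> B \<in> Obj C"
    and Fst_Hom: "\<lbrakk>A \<in> Obj C; B \<in> Obj C\<rbrakk> \<Longrightarrow> Fst C A B \<in> Hom C (A \<otimes> B) A"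
    and Snd_Hom: "\<lbrakk>A \<in> Obj C; B \<in> Obj C\<rbrakk> \<Longrightarrow> Snd C A B \<in> Hom C (A \<otimes> B) B"
    and Prod_universal:
      "\<lbrakk>A \<in> Obj C; B \<in> Obj C; f \<in> Hom C X A; g \<in> Hom C X B\<rbrakk> \<Longrightarrow>
       \<exists>!h. h \<in> Hom C X (A \<otimes> B) \<and> Fst C A B \<cdot> h = f \<and> Snd C A B \<cdot> h = g"

definition Tuple :: "('o, 'a, 'm) fp_category_scheme \<Rightarrow> 'a \<Rightarrow> 'a \<Rightarrow> 'a"
    (\<open>(\<open>notation=\<open>mixfix Tuple\<close>\<close>\<langle>_,/ _\<rangle>\<index>)\<close>) where
  "\<langle>f, g\<rangle>\<^bsub>C\<^esub> = (THE h. h \<in> Hom C (Dom C f) (Cod C f \<otimes>\<^bsub>C\<^esub> Cod C g)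
      \<and> Fst C (Cod C f) (Cod C g) \<cdot>\<^bsub>C\<^esub> h = f \<and> Snd C (Cod C f) (Cod C g) \<cdot>\<^bsub>C\<^esub> h = g)"

definition projection :: "('o, 'a, 'm) fp_category_scheme \<Rightarrow> 'a \<Rightarrow> bool" where
  "projection C p \<longleftrightarrow> (\<exists>A \<in> Obj C. \<exists>B \<in> Obj C. p = Fst C A B \<or> p = Snd C A B)"

text \<open>The square with top \<open>f'\<close>, right \<open>p\<close>, left \<open>p'\<close>, bottom \<open>f\<close>, commuting as
  \<open>p \<cdot> f' = f \<cdot> p'\<close>.\<close>

definition pullback_square ::
    "('o, 'a, 'm) category_scheme \<Rightarrow> 'a \<Rightarrow> 'a \<Rightarrow> 'a \<Rightarrow> 'a \<Rightarrow> bool" where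
  "pullback_square C f' p p' f \<longleftrightarrow>
     (\<exists>X' X A' A. f' \<in> Hom C X' X \<and> p \<in> Hom C X A \<and> p' \<in> Hom C X' A' \<and> f \<in> Hom C A' A
       \<and> p \<cdot>\<^bsub>C\<^esub> f' = f \<cdot>\<^bsub>C\<^esub> p'
       \<and> (\<forall>Y. \<forall>u \<in> Hom C Y X. \<forall>v \<in> Hom C Y A'. p \<cdot>\<^bsub>C\<^esub> u = f \<cdot>\<^bsub>C\<^esub> v \<longrightarrow>
            (\<exists>!h. h \<in> Hom C Y X' \<and> f' \<cdot>\<^bsub>C\<^esub> h = u \<and> p' \<cdot>\<^bsub>C\<^esub> h = v)))"

text \<open>\<open>Exp C A B\<close> is the exponential of the arrows from \<open>A\<close> to \<open>B\<close>, i.e. \<open>B\<^sup>A\<close>.\<close>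

record ('o, 'a) cc_category = "('o, 'a) fp_category" +
  Exp :: "'o \<Rightarrow> 'o \<Rightarrow> 'o"
  Ev  :: "'o \<Rightarrow> 'o \<Rightarrow> 'a"

locale cc_category = fp_category C
  for C :: "('o, 'a, 'm) cc_category_scheme" (structure) +
  assumes Exp_Obj: "\<lbrakk>A \<in> Obj C; B \<in> Obj C\<rbrakk> \<Longrightarrow> Exp C A B \<in> Obj C"
    and Ev_Hom: "\<lbrakk>A \<in> Obj C; B \<in> Obj C\<rbrakk> \<Longrightarrow> Ev C A B \<in> Hom C (Exp C A B \<otimes> A) B"
    and Exp_universal:
      "\<lbrakk>A \<in> Obj C; B \<in> Obj C; X \<in> Obj C; f \<in> Hom C (X \<otimes> A) B\<rbrakk> \<Longrightarrow>
       \<exists>!g. g \<in> Hom C X (Exp C A B) \<and> Ev C A B \<cdot> \<langle>g \<cdot> Fst C X A, Snd C X A\<rangle> = f"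


section \<open>Doctrines\<close>

record ('o, 'a, 'p) doctrine =
  fibre   :: "'o \<Rightarrow> 'p gorder"
  reindex :: "'a \<Rightarrow> 'p \<Rightarrow> 'p"

locale doctrine = fp_category C
  for C :: "('o, 'a, 'm) fp_category_scheme" (structure)
    and P :: "('o, 'a, 'p) doctrine" +
  assumes fibre_poset: "A \<in> Obj C \<Longrightarrow> partial_order (fibre P A)"
    and reindex_closed:
      "f \<in> Hom C A B \<Longrightarrow> reindex P f \<in> carrier (fibre P B) \<rightarrow> carrier (fibre P A)"
    and reindex_mono: "f \<in> Hom C A B \<Longrightarrow> isotone (fibre P B) (fibre P A) (reindex P f)"
    and reindex_Ide: "\<lbrakk>A \<in> Obj C; \<alpha> \<in> carrier (fibre P A)\<rbrakk> \<Longrightarrow> reindex P (Ide C A) \<alpha> = \<alpha>"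
    and reindex_Comp:
      "\<lbrakk>f \<in> Hom C A B; g \<in> Hom C B D; \<alpha> \<in> carrier (fibre P D)\<rbrakk> \<Longrightarrow>
       reindex P (g \<cdot> f) \<alpha> = reindex P f (reindex P g \<alpha>)"

definition left_adjoint_along ::
    "('o, 'a, 'm) category_scheme \<Rightarrow> ('o, 'a, 'p) doctrine \<Rightarrow> 'a \<Rightarrow> ('p \<Rightarrow> 'p) \<Rightarrow> bool" where
  "left_adjoint_along C P p L \<longleftrightarrow> galois_connection
     \<lparr>orderA = fibre P (Dom C p), orderB = fibre P (Cod C p), lower = L, upper = reindex P p\<rparr>"

definition right_adjoint_along ::
    "('o, 'a, 'm) category_scheme \<Rightarrow> ('o, 'a, 'p) doctrine \<Rightarrow> 'a \<Rightarrow> ('p \<Rightarrow> 'p) \<Rightarrow> bool" where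
  "right_adjoint_along C P p R \<longleftrightarrow> galois_connection
     \<lparr>orderA = fibre P (Cod C p), orderB = fibre P (Dom C p), lower = reindex P p, upper = R\<rparr>"

text \<open>Adjoints between posets are unique, so when they exist the values of \<open>SOME\<close> below on
  predicates of \<open>fibre P (Dom C p)\<close> are determined.\<close>

definition exists_along ::
    "('o, 'a, 'm) category_scheme \<Rightarrow> ('o, 'a, 'p) doctrine \<Rightarrow> 'a \<Rightarrow> 'p \<Rightarrow> 'p" where
  "exists_along C P p = (SOME L. left_adjoint_along C P p L)"

definition forall_along ::
    "('o, 'a, 'm) category_scheme \<Rightarrow> ('o, 'a, 'p) doctrine \<Rightarrow> 'a \<Rightarrow> 'p \<Rightarrow> 'p" where
  "forall_along C P p = (SOME R. right_adjoint_along C P p R)"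

definition existential ::
    "('o, 'a, 'm) fp_category_scheme \<Rightarrow> ('o, 'a, 'p) doctrine \<Rightarrow> bool" where
  "existential C P \<longleftrightarrow>
     (\<forall>p. projection C p \<longrightarrow> (\<exists>L. left_adjoint_along C P p L)) \<and>
     (\<forall>f' p p' f. projection C p \<longrightarrow> projection C p' \<longrightarrow> pullback_square C f' p p' f \<longrightarrow>
       (\<forall>\<beta> \<in> carrier (fibre P (Dom C p)).
         exists_along C P p' (reindex P f' \<beta>) = reindex P f (exists_along C P p \<beta>)))"

definition universal ::
    "('o, 'a, 'm) fp_category_scheme \<Rightarrow> ('o, 'a, 'p) doctrine \<Rightarrow> bool" where
  "universal C P \<longleftrightarrow>
     (\<forall>p. projection C p \<longrightarrow> (\<exists>R. right_adjoint_along C P p R)) \<and>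
     (\<forall>f' p p' f. projection C p \<longrightarrow> projection C p' \<longrightarrow> pullback_square C f' p p' f \<longrightarrow>
       (\<forall>\<beta> \<in> carrier (fibre P (Dom C p)).
         forall_along C P p' (reindex P f' \<beta>) = reindex P f (forall_along C P p \<beta>)))"

definition existential_splitting ::
    "('o, 'a, 'm) fp_category_scheme \<Rightarrow> ('o, 'a, 'p) doctrine \<Rightarrow> 'o \<Rightarrow> 'p \<Rightarrow> bool" where
  "existential_splitting C P A \<alpha> \<longleftrightarrow>
     (\<forall>B \<in> Obj C. \<forall>\<beta> \<in> carrier (fibre P (A \<otimes>\<^bsub>C\<^esub> B)).
        \<alpha> \<sqsubseteq>\<^bsub>fibre P A\<^esub> exists_along C P (Fst C A B) \<beta> \<longrightarrow>
        (\<exists>g \<in> Hom C A B. \<alpha> \<sqsubseteq>\<^bsub>fibre P A\<^esub> reindex P \<langle>Ide C A, g\<rangle>\<^bsub>C\<^esub> \<beta>))"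

definition existential_free ::
    "('o, 'a, 'm) fp_category_scheme \<Rightarrow> ('o, 'a, 'p) doctrine \<Rightarrow> 'o \<Rightarrow> 'p \<Rightarrow> bool" where
  "existential_free C P I \<alpha> \<longleftrightarrow>
     (\<forall>A \<in> Obj C. \<forall>f \<in> Hom C A I. existential_splitting C P A (reindex P f \<alpha>))"

definition enough_existential_free ::
    "('o, 'a, 'm) fp_category_scheme \<Rightarrow> ('o, 'a, 'p) doctrine \<Rightarrow> bool" where
  "enough_existential_free C P \<longleftrightarrow>
     (\<forall>I \<in> Obj C. \<forall>\<alpha> \<in> carrier (fibre P I). \<exists>A \<in> Obj C. \<exists>\<beta> \<in> carrier (fibre P (I \<otimes>\<^bsub>C\<^esub> A)).
        existential_free C P (I \<otimes>\<^bsub>C\<^esub> A) \<beta> \<and> \<alpha> = exists_along C P (Fst C I A) \<beta>)"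

locale skolem_doctrine = cc_category C + doctrine C P
  for C :: "('o, 'a, 'm) cc_category_scheme" (structure)
    and P :: "('o, 'a, 'p) doctrine" +
  assumes existential: "existential C P"
    and universal: "universal C P"
    and enough_existential_free: "enough_existential_free C P"
    and forall_existential_free:
      "\<lbrakk>projection C p; \<alpha> \<in> carrier (fibre P (Dom C p)); existential_free C P (Dom C p) \<alpha>\<rbrakk> \<Longrightarrow>
       existential_free C P (Cod C p) (forall_along C P p \<alpha>)"

text \<open>The substitution \<open>(a, f, b) \<mapsto> (a, b, ev(f, b))\<close>, an arrow from \<open>(A \<otimes> Exp C B D) \<otimes> B\<close> to
  \<open>(A \<otimes> B) \<otimes> D\<close>; contexts with several variables are bracketed to the left.\<close>

definition skolem_subst :: "('o, 'a, 'm) cc_category_scheme \<Rightarrow> 'o \<Rightarrow> 'o \<Rightarrow> 'o \<Rightarrow> 'a" where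
  "skolem_subst C A B D =
    (let E = Exp C B D;
         a = Fst C A E \<cdot>\<^bsub>C\<^esub> Fst C (A \<otimes>\<^bsub>C\<^esub> E) B;
         f = Snd C A E \<cdot>\<^bsub>C\<^esub> Fst C (A \<otimes>\<^bsub>C\<^esub> E) B;
         b = Snd C (A \<otimes>\<^bsub>C\<^esub> E) B
     in \<langle>\<langle>a, b\<rangle>\<^bsub>C\<^esub>, Ev C B D \<cdot>\<^bsub>C\<^esub> \<langle>f, b\<rangle>\<^bsub>C\<^esub>\<rangle>\<^bsub>C\<^esub>)"

end

theory Submission
  imports Defs
begin

text \<open>Write \<open>\<phi> = \<forall>b. \<exists>c. \<alpha>\<close> as \<open>\<exists>x : X. \<beta>(a, x)\<close> with \<open>\<beta>\<close> existential-free. Then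
  \<open>\<beta>(a, x) \<turnstile> \<exists>c. \<alpha>(a, b, c)\<close> in context \<open>a, x, b\<close>; since \<open>\<beta>\<close> weakened by \<open>b\<close> splits, there is
  an arrow \<open>g\<close> with \<open>\<beta>(a, x) \<turnstile> \<alpha>(a, b, g(a, x, b))\<close>. The transpose of \<open>g\<close> in \<open>b\<close> is the
  witness for \<open>\<exists>f : C\<^sup>B\<close>. The converse holds in any doctrine with both quantifiers.\<close>

context category
begin

lemma Hom_Dom: "f \<in> Hom C A B \<Longrightarrow> Dom C f = A"
  and Hom_Cod: "f \<in> Hom C A B \<Longrightarrow> Cod C f = B"
  by (simp_all add: Hom_def)

lemma Hom_Obj_Dom: "f \<in> Hom C A B \<Longrightarrow> A \<in> Obj C"
  and Hom_Obj_Cod: "f \<in> Hom C A B \<Longrightarrow> B \<in> Obj C"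
  using Dom_Obj Cod_Obj by (auto simp: Hom_def)

end

section \<open>Pairing, and pullbacks of projections\<close>

context fp_category
begin

text \<open>\<open>Tuple\<close> is a definite description that reads its objects off domains and
  codomains; once the homsets are known, \<open>Prod_universal\<close> makes it denote.\<close>

lemma Tuple_props:
  assumes f: "f \<in> Hom C X A" and g: "g \<in> Hom C X B"
  shows Tuple_Hom: "\<langle>f, g\<rangle> \<in> Hom C X (A \<otimes> B)"
    and Fst_Tuple: "Fst C A B \<cdot> \<langle>f, g\<rangle> = f"
    and Snd_Tuple: "Snd C A B \<cdot> \<langle>f, g\<rangle> = g"
proof -
  have "\<exists>!h. h \<in> Hom C X (A \<otimes> B) \<and> Fst C A B \<cdot> h = f \<and> Snd C A B \<cdot> h = g"
    using Prod_universal Hom_Obj_Cod f g by blast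
  from theI'[OF this]
  have "\<langle>f, g\<rangle> \<in> Hom C X (A \<otimes> B) \<and> Fst C A B \<cdot> \<langle>f, g\<rangle> = f \<and> Snd C A B \<cdot> \<langle>f, g\<rangle> = g"
    unfolding Tuple_def Hom_Dom[OF f] Hom_Cod[OF f] Hom_Cod[OF g] .
  then show "\<langle>f, g\<rangle> \<in> Hom C X (A \<otimes> B)" "Fst C A B \<cdot> \<langle>f, g\<rangle> = f" "Snd C A B \<cdot> \<langle>f, g\<rangle> = g"
    by auto
qed

lemma prod_eqI:
  assumes "A \<in> Obj C" "B \<in> Obj C" "h \<in> Hom C X (A \<otimes> B)" "k \<in> Hom C X (A \<otimes> B)"
    and "Fst C A B \<cdot> h = Fst C A B \<cdot> k" "Snd C A B \<cdot> h = Snd C A B \<cdot> k"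
  shows "h = k"
proof -
  have "Fst C A B \<cdot> k \<in> Hom C X A" "Snd C A B \<cdot> k \<in> Hom C X B"
    using assms Comp_Hom Fst_Hom Snd_Hom by blast+
  from Prod_universal[OF assms(1,2) this] show ?thesis
    using assms by blast
qed

lemma Tuple_Comp:
  assumes h: "h \<in> Hom C Y X" and f: "f \<in> Hom C X A" and g: "g \<in> Hom C X B"
  shows "\<langle>f, g\<rangle> \<cdot> h = \<langle>f \<cdot> h, g \<cdot> h\<rangle>"
proof -
  have A: "A \<in> Obj C" and B: "B \<in> Obj C" using f g Hom_Obj_Cod by blast+
  note fg = Tuple_props[OF f g]
  note fgh = Tuple_props[OF Comp_Hom[OF h f] Comp_Hom[OF h g]]
  show ?thesis
    by (rule prod_eqI[OF A B Comp_Hom[OF h fg(1)] fgh(1)])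
      (simp_all add: fgh fg Comp_assoc[OF h fg(1) Fst_Hom[OF A B], symmetric]
        Comp_assoc[OF h fg(1) Snd_Hom[OF A B], symmetric])
qed

lemma projection_Fst: "\<lbrakk>A \<in> Obj C; B \<in> Obj C\<rbrakk> \<Longrightarrow> projection C (Fst C A B)"
  by (auto simp: projection_def)

text \<open>The arrow f \<times> 1: substitution by \<open>f\<close> that carries along a further
  variable of type \<open>B\<close>. This is literally the pairing that occurs in
  \<open>Exp_universal\<close>, so it also serves for currying.\<close>

abbreviation lift_ctx :: "'a \<Rightarrow> 'o \<Rightarrow> 'o \<Rightarrow> 'a" where
  "lift_ctx f X B \<equiv> \<langle>f \<cdot> Fst C X B, Snd C X B\<rangle>"

lemma lift_ctx_Hom:
  assumes "f \<in> Hom C X A" "B \<in> Obj C"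
  shows "lift_ctx f X B \<in> Hom C (X \<otimes> B) (A \<otimes> B)"
proof -
  have X: "X \<in> Obj C" using assms(1) by (rule Hom_Obj_Dom)
  show ?thesis
    by (rule Tuple_Hom[OF Comp_Hom[OF Fst_Hom[OF X assms(2)] assms(1)] Snd_Hom[OF X assms(2)]])
qed

text \<open>These are the squares at which both Beck-Chevalley conditions are applied: substitution
  in a context against weakening by one more variable.\<close>

lemma pullback_square_Fst:
  assumes f: "f \<in> Hom C X A" and B: "B \<in> Obj C"
  shows "pullback_square C (lift_ctx f X B) (Fst C A B) (Fst C X B) f"
proof -
  have X: "X \<in> Obj C" and A: "A \<in> Obj C" using f Hom_Obj_Dom Hom_Obj_Cod by blast+
  note F = Fst_Hom[OF X B] and S = Snd_Hom[OF X B]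
  note FA = Fst_Hom[OF A B] and SA = Snd_Hom[OF A B]
  note fF = Comp_Hom[OF F f]
  note l = Tuple_props[OF fF S]
  have "\<exists>!h. h \<in> Hom C Y (X \<otimes> B) \<and> lift_ctx f X B \<cdot> h = u \<and> Fst C X B \<cdot> h = v"
    if u: "u \<in> Hom C Y (A \<otimes> B)" and v: "v \<in> Hom C Y X" and uv: "Fst C A B \<cdot> u = f \<cdot> v" for Y u v
  proof
    have Su: "Snd C A B \<cdot> u \<in> Hom C Y B" using Comp_Hom[OF u SA] .
    \<comment> \<open>By \<open>uv\<close> the first component of \<open>u\<close> is determined by
      \<open>v\<close>, so the mediating arrow needs only \<open>v\<close> and the second component
      of \<open>u\<close>.\<close>
    let ?h = "\<langle>v, Snd C A B \<cdot> u\<rangle>"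
    note h = Tuple_props[OF v Su]
    have "lift_ctx f X B \<cdot> ?h = \<langle>f \<cdot> v, Snd C A B \<cdot> u\<rangle>"
      by (simp add: Tuple_Comp[OF h(1) fF S] Comp_assoc[OF h(1) F f] h)
    also have "\<dots> = u"
      using Tuple_props[OF Comp_Hom[OF v f] Su] uv by (intro prod_eqI[OF A B _ u]) auto
    finally show "?h \<in> Hom C Y (X \<otimes> B) \<and> lift_ctx f X B \<cdot> ?h = u \<and> Fst C X B \<cdot> ?h = v"
      using h by simp
    fix k assume k: "k \<in> Hom C Y (X \<otimes> B) \<and> lift_ctx f X B \<cdot> k = u \<and> Fst C X B \<cdot> k = v"
    \<comment> \<open>Lifting \<open>f\<close> leaves the variable of type \<open>B\<close>
      untouched, so the second component of \<open>k\<close> can be read off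
      \<open>u\<close>.\<close>
    then have "Snd C X B \<cdot> k = Snd C A B \<cdot> u"
      using Comp_assoc[OF _ l(1) SA, of k] l(3) by auto
    with k h show "k = ?h" by (intro prod_eqI[OF X B, of k Y ?h]) simp_all
  qed
  then show ?thesis
    unfolding pullback_square_def using l FA F f by blast
qed

end

section \<open>Order and quantifiers in the fibres\<close>

context doctrine
begin

lemma reindex_in: "\<lbrakk>f \<in> Hom C A B; \<beta> \<in> carrier (fibre P B)\<rbrakk> \<Longrightarrow> reindex P f \<beta> \<in> carrier (fibre P A)"
  using reindex_closed by blast

lemma reindex_le:
  "\<lbrakk>f \<in> Hom C A B; \<beta> \<in> carrier (fibre P B); \<gamma> \<in> carrier (fibre P B); \<beta> \<sqsubseteq>\<^bsub>fibre P B\<^esub> \<gamma>\<rbrakk>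
    \<Longrightarrow> reindex P f \<beta> \<sqsubseteq>\<^bsub>fibre P A\<^esub> reindex P f \<gamma>"
  using reindex_mono use_iso2 by metis

lemma fibre_trans:
  assumes "A \<in> Obj C" "x \<sqsubseteq>\<^bsub>fibre P A\<^esub> y" "y \<sqsubseteq>\<^bsub>fibre P A\<^esub> z"
    "x \<in> carrier (fibre P A)" "y \<in> carrier (fibre P A)" "z \<in> carrier (fibre P A)"
  shows "x \<sqsubseteq>\<^bsub>fibre P A\<^esub> z"
proof -
  interpret partial_order "fibre P A" using fibre_poset assms(1) .
  show ?thesis using le_trans assms(2-) by blast
qed

lemma fibre_refl:
  assumes "A \<in> Obj C" "x \<in> carrier (fibre P A)"
  shows "x \<sqsubseteq>\<^bsub>fibre P A\<^esub> x"
proof -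
  interpret partial_order "fibre P A" using fibre_poset assms(1) .
  show ?thesis using le_refl assms(2) .
qed

text \<open>Since some left adjoint exists, the one chosen by \<open>SOME\<close> is a left adjoint.
  From here on \<exists> is handled through its adjunction; the dual facts for \<forall> are
  obtained in the same way.\<close>

lemma
  assumes "existential C P" and p: "projection C p" "p \<in> Hom C X A"
    and \<beta>: "\<beta> \<in> carrier (fibre P X)"
  shows exists_in: "exists_along C P p \<beta> \<in> carrier (fibre P A)"
    and exists_le_iff: "\<gamma> \<in> carrier (fibre P A) \<Longrightarrow>
      exists_along C P p \<beta> \<sqsubseteq>\<^bsub>fibre P A\<^esub> \<gamma> \<longleftrightarrow> \<beta> \<sqsubseteq>\<^bsub>fibre P X\<^esub> reindex P p \<gamma>"
proof -
  have "\<exists>L. left_adjoint_along C P p L"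
    using assms(1) p by (simp add: existential_def)
  then have "left_adjoint_along C P p (exists_along C P p)"
    unfolding exists_along_def by (rule someI_ex)
  then interpret galois_connection "\<lparr>orderA = fibre P X, orderB = fibre P A,
      lower = exists_along C P p, upper = reindex P p\<rparr>"
    by (simp add: left_adjoint_along_def Hom_Dom[OF p(2)] Hom_Cod[OF p(2)])
  show "exists_along C P p \<beta> \<in> carrier (fibre P A)"
    using lower_closed \<beta> by simp
  show "\<gamma> \<in> carrier (fibre P A) \<Longrightarrow>
      exists_along C P p \<beta> \<sqsubseteq>\<^bsub>fibre P A\<^esub> \<gamma> \<longleftrightarrow> \<beta> \<sqsubseteq>\<^bsub>fibre P X\<^esub> reindex P p \<gamma>"
    using galois_property \<beta> by simp
qed

text \<open>The unit of the adjunction, from \<open>exists_le_iff\<close> with \<gamma> the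
  quantified predicate itself.\<close>

lemma le_reindex_exists:
  assumes "existential C P" and p: "projection C p" "p \<in> Hom C X A"
    and \<beta>: "\<beta> \<in> carrier (fibre P X)"
  shows "\<beta> \<sqsubseteq>\<^bsub>fibre P X\<^esub> reindex P p (exists_along C P p \<beta>)"
  using exists_le_iff[OF assms exists_in[OF assms]]
    fibre_refl[OF Hom_Obj_Cod[OF p(2)] exists_in[OF assms]] by simp

lemma
  assumes "universal C P" and p: "projection C p" "p \<in> Hom C X A"
    and \<beta>: "\<beta> \<in> carrier (fibre P X)"
  shows forall_in: "forall_along C P p \<beta> \<in> carrier (fibre P A)"
    and le_forall_iff: "\<gamma> \<in> carrier (fibre P A) \<Longrightarrow>
      \<gamma> \<sqsubseteq>\<^bsub>fibre P A\<^esub> forall_along C P p \<beta> \<longleftrightarrow> reindex P p \<gamma> \<sqsubseteq>\<^bsub>fibre P X\<^esub> \<beta>"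
proof -
  have "\<exists>R. right_adjoint_along C P p R"
    using assms(1) p by (simp add: universal_def)
  then have "right_adjoint_along C P p (forall_along C P p)"
    unfolding forall_along_def by (rule someI_ex)
  then interpret galois_connection "\<lparr>orderA = fibre P A, orderB = fibre P X,
      lower = reindex P p, upper = forall_along C P p\<rparr>"
    by (simp add: right_adjoint_along_def Hom_Dom[OF p(2)] Hom_Cod[OF p(2)])
  show "forall_along C P p \<beta> \<in> carrier (fibre P A)"
    using upper_closed \<beta> by simp
  show "\<gamma> \<in> carrier (fibre P A) \<Longrightarrow>
      \<gamma> \<sqsubseteq>\<^bsub>fibre P A\<^esub> forall_along C P p \<beta> \<longleftrightarrow> reindex P p \<gamma> \<sqsubseteq>\<^bsub>fibre P X\<^esub> \<beta>"
    using galois_property \<beta> by simp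
qed

text \<open>Beck-Chevalley at the square of \<open>pullback_square_Fst\<close>: a substitution in
  the free variables passes under the quantifier.\<close>

lemma exists_reindex:
  assumes "existential C P" and f: "f \<in> Hom C X A" and B: "B \<in> Obj C"
    and "\<beta> \<in> carrier (fibre P (A \<otimes> B))"
  shows "exists_along C P (Fst C X B) (reindex P (lift_ctx f X B) \<beta>)
    = reindex P f (exists_along C P (Fst C A B) \<beta>)"
proof -
  have X: "X \<in> Obj C" and A: "A \<in> Obj C" using f Hom_Obj_Dom Hom_Obj_Cod by blast+
  show ?thesis
    using assms(1,4) pullback_square_Fst[OF f B] projection_Fst[OF A B] projection_Fst[OF X B]
    unfolding existential_def by (simp add: Hom_Dom[OF Fst_Hom[OF A B]])
qed

lemma forall_reindex:
  assumes "universal C P" and f: "f \<in> Hom C X A" and B: "B \<in> Obj C"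
    and "\<beta> \<in> carrier (fibre P (A \<otimes> B))"
  shows "forall_along C P (Fst C X B) (reindex P (lift_ctx f X B) \<beta>)
    = reindex P f (forall_along C P (Fst C A B) \<beta>)"
proof -
  have X: "X \<in> Obj C" and A: "A \<in> Obj C" using f Hom_Obj_Dom Hom_Obj_Cod by blast+
  show ?thesis
    using assms(1,4) pullback_square_Fst[OF f B] projection_Fst[OF A B] projection_Fst[OF X B]
    unfolding universal_def by (simp add: Hom_Dom[OF Fst_Hom[OF A B]])
qed

text \<open>Introduction and elimination of \<forall> under a substitution \<open>f\<close>:
  Beck-Chevalley moves \<open>f\<close> under the quantifier, then the right adjunction removes the
  quantifier.\<close>

lemma le_reindex_forall_iff:
  assumes "universal C P" and f: "f \<in> Hom C X A" and B: "B \<in> Obj C"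
    and \<beta>: "\<beta> \<in> carrier (fibre P (A \<otimes> B))" and \<gamma>: "\<gamma> \<in> carrier (fibre P X)"
  shows "\<gamma> \<sqsubseteq>\<^bsub>fibre P X\<^esub> reindex P f (forall_along C P (Fst C A B) \<beta>) \<longleftrightarrow>
    reindex P (Fst C X B) \<gamma> \<sqsubseteq>\<^bsub>fibre P (X \<otimes> B)\<^esub> reindex P (lift_ctx f X B) \<beta>"
proof -
  have X: "X \<in> Obj C" using f by (rule Hom_Obj_Dom)
  show ?thesis
    using le_forall_iff[OF assms(1) projection_Fst[OF X B] Fst_Hom[OF X B]
        reindex_in[OF lift_ctx_Hom[OF f B] \<beta>] \<gamma>]
    by (simp add: forall_reindex[OF assms(1) f B \<beta>])
qed

end

section \<open>The substitution by evaluation\<close>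

lemma (in cc_category) skolem_subst_props:
  assumes A: "A \<in> Obj C" and B: "B \<in> Obj C" and D: "D \<in> Obj C"
  defines "E \<equiv> Exp C B D"
  shows skolem_subst_Hom: "skolem_subst C A B D \<in> Hom C (A \<otimes> E \<otimes> B) (A \<otimes> B \<otimes> D)"
    and Fst_skolem_subst:
      "Fst C (A \<otimes> B) D \<cdot> skolem_subst C A B D = lift_ctx (Fst C A E) (A \<otimes> E) B"
    and Snd_skolem_subst: "Snd C (A \<otimes> B) D \<cdot> skolem_subst C A B D
      = Ev C B D \<cdot> lift_ctx (Snd C A E) (A \<otimes> E) B"
proof -
  have E: "E \<in> Obj C" using Exp_Obj B D by (simp add: E_def)
  note AE = Prod_Obj[OF A E]
  \<comment> \<open>The inner pairs (a, b) and (f, b) of \<open>skolem_subst\<close> are the lifts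
    of the two projections of \<open>A \<otimes> E\<close>.\<close>
  have "lift_ctx (Fst C A E) (A \<otimes> E) B \<in> Hom C (A \<otimes> E \<otimes> B) (A \<otimes> B)"
    by (rule lift_ctx_Hom[OF Fst_Hom[OF A E] B])
  moreover have "Ev C B D \<cdot> lift_ctx (Snd C A E) (A \<otimes> E) B \<in> Hom C (A \<otimes> E \<otimes> B) D"
    using Comp_Hom[OF lift_ctx_Hom[OF Snd_Hom[OF A E] B]] Ev_Hom[OF B D] by (simp add: E_def)
  ultimately show "skolem_subst C A B D \<in> Hom C (A \<otimes> E \<otimes> B) (A \<otimes> B \<otimes> D)"
    "Fst C (A \<otimes> B) D \<cdot> skolem_subst C A B D = lift_ctx (Fst C A E) (A \<otimes> E) B"
    "Snd C (A \<otimes> B) D \<cdot> skolem_subst C A B D = Ev C B D \<cdot> lift_ctx (Snd C A E) (A \<otimes> E) B"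
    unfolding skolem_subst_def Let_def E_def[symmetric] by (rule Tuple_props)+
qed

text \<open>Instantiating (a, f) by (u(x), g(x)) turns (a, b, ev(f, b)) into (u(x), b, ev(g(x), b)).
  When \<open>g\<close> is a transpose, the last entry is the arrow it was curried from.\<close>

lemma (in cc_category) skolem_subst_lift_ctx:
  assumes B: "B \<in> Obj C" and D: "D \<in> Obj C"
    and u: "u \<in> Hom C X A" and g: "g \<in> Hom C X (Exp C B D)"
  shows "skolem_subst C A B D \<cdot> lift_ctx \<langle>u, g\<rangle> X B
    = \<langle>lift_ctx u X B, Ev C B D \<cdot> lift_ctx g X B\<rangle>"
proof -
  let ?E = "Exp C B D"
  have X: "X \<in> Obj C" and A: "A \<in> Obj C" using u Hom_Obj_Dom Hom_Obj_Cod by blast+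
  note E = Exp_Obj[OF B D]
  note AE = Prod_Obj[OF A E] and AB = Prod_Obj[OF A B]
  note h = Tuple_props[OF u g]
  note F = Fst_Hom[OF X B] and S = Snd_Hom[OF X B]
  note l = lift_ctx_Hom[OF h(1) B]
  note lp = Tuple_props[OF Comp_Hom[OF F h(1)] S]
  \<comment> \<open>Functoriality of lifting; at the two projections of
    \<open>A \<otimes> ?E\<close> it yields the lifts of \<open>u\<close> and
    \<open>g\<close>.\<close>
  have lift: "lift_ctx q (A \<otimes> ?E) B \<cdot> lift_ctx \<langle>u, g\<rangle> X B = lift_ctx (q \<cdot> \<langle>u, g\<rangle>) X B"
    if q: "q \<in> Hom C (A \<otimes> ?E) Z" for q Z
    using Tuple_Comp[OF l Comp_Hom[OF Fst_Hom[OF AE B] q] Snd_Hom[OF AE B]]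
      Comp_assoc[OF l Fst_Hom[OF AE B] q] Comp_assoc[OF F h(1) q] lp by simp
  note s = skolem_subst_props[OF A B D]
  have uB: "lift_ctx u X B \<in> Hom C (X \<otimes> B) (A \<otimes> B)"
    and gB: "Ev C B D \<cdot> lift_ctx g X B \<in> Hom C (X \<otimes> B) D"
    using lift_ctx_Hom[OF u B] Comp_Hom[OF lift_ctx_Hom[OF g B] Ev_Hom[OF B D]] by auto
  note t = Tuple_props[OF uB gB]
  show ?thesis
  proof (rule prod_eqI[OF AB D Comp_Hom[OF l s(1)] t(1)])
    show "Fst C (A \<otimes> B) D \<cdot> (skolem_subst C A B D \<cdot> lift_ctx \<langle>u, g\<rangle> X B)
      = Fst C (A \<otimes> B) D \<cdot> \<langle>lift_ctx u X B, Ev C B D \<cdot> lift_ctx g X B\<rangle>"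
      using Comp_assoc[OF l s(1) Fst_Hom[OF AB D]] s(2) t(2) lift[OF Fst_Hom[OF A E]] h(2) by simp
    show "Snd C (A \<otimes> B) D \<cdot> (skolem_subst C A B D \<cdot> lift_ctx \<langle>u, g\<rangle> X B)
      = Snd C (A \<otimes> B) D \<cdot> \<langle>lift_ctx u X B, Ev C B D \<cdot> lift_ctx g X B\<rangle>"
      using Comp_assoc[OF l s(1) Snd_Hom[OF AB D]] s(3) t(3) lift[OF Snd_Hom[OF A E]] h(3)
        Comp_assoc[OF l lift_ctx_Hom[OF Snd_Hom[OF A E] B] Ev_Hom[OF B D]] by simp
  qed
qed

section \<open>The two entailments\<close>

context skolem_doctrine
begin

context
  fixes A B D :: 'o and \<alpha> :: 'p
  assumes A: "A \<in> Obj C" and B: "B \<in> Obj C" and D: "D \<in> Obj C"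
    and \<alpha>: "\<alpha> \<in> carrier (fibre P (A \<otimes> B \<otimes> D))"
begin

abbreviation (input) "E \<equiv> Exp C B D"
abbreviation (input) "ex\<alpha> \<equiv> exists_along C P (Fst C (A \<otimes> B) D) \<alpha>"
abbreviation (input) "\<phi> \<equiv> forall_along C P (Fst C A B) ex\<alpha>"
abbreviation (input) "\<sigma> \<equiv> reindex P (skolem_subst C A B D) \<alpha>"
text \<open>In context a, f, this says that f is a Skolem function at a.\<close>

abbreviation (input) "\<chi> \<equiv> forall_along C P (Fst C (A \<otimes> E) B) \<sigma>"
abbreviation (input) "\<psi> \<equiv> exists_along C P (Fst C A E) \<chi>"

lemmas E_Obj = Exp_Obj[OF B D]
lemmas AB_Obj = Prod_Obj[OF A B]
lemmas AE_Obj = Prod_Obj[OF A E_Obj]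

lemmas ex\<alpha>_in = exists_in[OF existential projection_Fst[OF AB_Obj D] Fst_Hom[OF AB_Obj D] \<alpha>]
lemmas \<phi>_in = forall_in[OF universal projection_Fst[OF A B] Fst_Hom[OF A B] ex\<alpha>_in]
lemmas \<sigma>_in = reindex_in[OF skolem_subst_Hom[OF A B D] \<alpha>]
lemmas \<chi>_in = forall_in[OF universal projection_Fst[OF AE_Obj B] Fst_Hom[OF AE_Obj B] \<sigma>_in]
lemmas \<psi>_in = exists_in[OF existential projection_Fst[OF A E_Obj] Fst_Hom[OF A E_Obj] \<chi>_in]

text \<open>A Skolem function f supplies ev(f, b) as the witness for c at each b. The entailment is
  proved in context a, f, b and then transposed, first along \<forall> over b and then along
  \<exists> over f.\<close>

lemma skolem_backward: "\<psi> \<sqsubseteq>\<^bsub>fibre P A\<^esub> \<phi>"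
proof -
  note s = skolem_subst_Hom[OF A B D]
  note F = Fst_Hom[OF AB_Obj D]
  note AEB = Prod_Obj[OF AE_Obj B]
  note FAEB = Fst_Hom[OF AE_Obj B]
  \<comment> \<open>The counit of the adjunction for \<forall>.\<close>
  have "reindex P (Fst C (A \<otimes> E) B) \<chi> \<sqsubseteq>\<^bsub>fibre P (A \<otimes> E \<otimes> B)\<^esub> \<sigma>"
    using le_forall_iff[OF universal projection_Fst[OF AE_Obj B] FAEB \<sigma>_in \<chi>_in]
      fibre_refl[OF AE_Obj \<chi>_in] by simp
  \<comment> \<open>The unit for \<exists> over c, substituted along \<open>skolem_subst\<close>.
    Forgetting the last entry of (a, b, ev(f, b)) leaves the lift of the projection to
    \<open>A\<close>.\<close>
  moreover have "\<sigma> \<sqsubseteq>\<^bsub>fibre P (A \<otimes> E \<otimes> B)\<^esub> reindex P (lift_ctx (Fst C A E) (A \<otimes> E) B) ex\<alpha>"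
    using reindex_le[OF s \<alpha> reindex_in[OF F ex\<alpha>_in]
        le_reindex_exists[OF existential projection_Fst[OF AB_Obj D] F \<alpha>]]
    by (simp add: reindex_Comp[OF s F ex\<alpha>_in, symmetric] Fst_skolem_subst[OF A B D])
  ultimately have "reindex P (Fst C (A \<otimes> E) B) \<chi>
      \<sqsubseteq>\<^bsub>fibre P (A \<otimes> E \<otimes> B)\<^esub> reindex P (lift_ctx (Fst C A E) (A \<otimes> E) B) ex\<alpha>"
    by (rule fibre_trans[OF AEB]) (intro reindex_in[OF FAEB \<chi>_in] \<sigma>_in
      reindex_in[OF lift_ctx_Hom[OF Fst_Hom[OF A E_Obj] B] ex\<alpha>_in])+
  then have "\<chi> \<sqsubseteq>\<^bsub>fibre P (A \<otimes> E)\<^esub> reindex P (Fst C A E) \<phi>"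
    using le_reindex_forall_iff[OF universal Fst_Hom[OF A E_Obj] B ex\<alpha>_in \<chi>_in] by simp
  then show ?thesis
    using exists_le_iff[OF existential projection_Fst[OF A E_Obj] Fst_Hom[OF A E_Obj] \<chi>_in \<phi>_in]
    by simp
qed

lemma skolem_forward: "\<phi> \<sqsubseteq>\<^bsub>fibre P A\<^esub> \<psi>"
proof -
  obtain X \<beta> where X: "X \<in> Obj C" and \<beta>: "\<beta> \<in> carrier (fibre P (A \<otimes> X))"
    and free: "existential_free C P (A \<otimes> X) \<beta>"
    and \<phi>_eq: "\<phi> = exists_along C P (Fst C A X) \<beta>"
    using enough_existential_free A \<phi>_in unfolding enough_existential_free_def by blast
  note AX = Prod_Obj[OF A X]
  note AXB = Prod_Obj[OF AX B]
  note u = Fst_Hom[OF A X]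
  note F = Fst_Hom[OF AX B]
  \<comment> \<open>The substitution (a, x, b) \<mapsto> (a, b), kept in lifted form so that
    \<open>le_reindex_forall_iff\<close> applies.\<close>
  define k where "k = lift_ctx (Fst C A X) (A \<otimes> X) B"
  have k: "k \<in> Hom C (A \<otimes> X \<otimes> B) (A \<otimes> B)"
    unfolding k_def by (rule lift_ctx_Hom[OF u B])
  note kD = lift_ctx_Hom[OF k D]
  let ?\<beta>' = "reindex P (Fst C (A \<otimes> X) B) \<beta>"
  have "\<beta> \<sqsubseteq>\<^bsub>fibre P (A \<otimes> X)\<^esub> reindex P (Fst C A X) \<phi>"
    unfolding \<phi>_eq by (rule le_reindex_exists[OF existential projection_Fst[OF A X] u \<beta>])
  then have "?\<beta>' \<sqsubseteq>\<^bsub>fibre P (A \<otimes> X \<otimes> B)\<^esub> reindex P k ex\<alpha>"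
    unfolding k_def using le_reindex_forall_iff[OF universal u B ex\<alpha>_in \<beta>] by simp
  \<comment> \<open>Moving \<open>k\<close> under \<exists> gives the bound the form required by
    \<open>existential_splitting\<close>, in context a, x, b.\<close>
  then have "?\<beta>' \<sqsubseteq>\<^bsub>fibre P (A \<otimes> X \<otimes> B)\<^esub>
      exists_along C P (Fst C (A \<otimes> X \<otimes> B) D) (reindex P (lift_ctx k (A \<otimes> X \<otimes> B) D) \<alpha>)"
    by (simp add: exists_reindex[OF existential k D \<alpha>])
  \<comment> \<open>Freeness makes every reindexing of \<beta> split, in particular its weakening by
    b. The witness \<open>g\<close> may therefore depend on b.\<close>
  moreover have "existential_splitting C P (A \<otimes> X \<otimes> B) ?\<beta>'"
    using free F AXB unfolding existential_free_def by blast
  ultimately obtain g where g: "g \<in> Hom C (A \<otimes> X \<otimes> B) D"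
    and le: "?\<beta>' \<sqsubseteq>\<^bsub>fibre P (A \<otimes> X \<otimes> B)\<^esub>
      reindex P \<langle>Ide C (A \<otimes> X \<otimes> B), g\<rangle> (reindex P (lift_ctx k (A \<otimes> X \<otimes> B) D) \<alpha>)"
    using D reindex_in[OF kD \<alpha>] unfolding existential_splitting_def by blast
  obtain g' where g': "g' \<in> Hom C (A \<otimes> X) E"
    and ev: "Ev C B D \<cdot> lift_ctx g' (A \<otimes> X) B = g"
    using Exp_universal[OF B D AX g] by blast
  note I = Ide_Hom[OF AXB]
  note t = Tuple_props[OF I g]
  \<comment> \<open>The substitution (a, x) \<mapsto> (a, g'(a, x)), which names the Skolem function
    and keeps a fixed.\<close>
  define h where "h = \<langle>Fst C A X, g'\<rangle>"
  have h: "h \<in> Hom C (A \<otimes> X) (A \<otimes> E)" and Fst_h: "Fst C A E \<cdot> h = Fst C A X"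
    using Tuple_props[OF u g'] by (auto simp: h_def)
  note hB = lift_ctx_Hom[OF h B]
  \<comment> \<open>Both routes send (a, x, b) to (a, b, g(a, x, b)); \<open>ev\<close> identifies
    the evaluated transpose with \<open>g\<close>.\<close>
  have "lift_ctx k (A \<otimes> X \<otimes> B) D \<cdot> \<langle>Ide C (A \<otimes> X \<otimes> B), g\<rangle> = \<langle>k, g\<rangle>"
    using Tuple_Comp[OF t(1) Comp_Hom[OF Fst_Hom[OF AXB D] k] Snd_Hom[OF AXB D]]
      Comp_assoc[OF t(1) Fst_Hom[OF AXB D] k] t Comp_Ide[OF k] by simp
  also have "\<dots> = skolem_subst C A B D \<cdot> lift_ctx h (A \<otimes> X) B"
    unfolding h_def using skolem_subst_lift_ctx[OF B D u g'] ev k_def by simp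
  finally have "?\<beta>' \<sqsubseteq>\<^bsub>fibre P (A \<otimes> X \<otimes> B)\<^esub> reindex P (lift_ctx h (A \<otimes> X) B) \<sigma>"
    using le reindex_Comp[OF t(1) kD \<alpha>] reindex_Comp[OF hB skolem_subst_Hom[OF A B D] \<alpha>] by simp
  then have "\<beta> \<sqsubseteq>\<^bsub>fibre P (A \<otimes> X)\<^esub> reindex P h \<chi>"
    using le_reindex_forall_iff[OF universal h B \<sigma>_in \<beta>] by simp
  \<comment> \<open>The unit for \<exists> over f, substituted along \<open>h\<close>; by
    \<open>Fst_h\<close> only a weakening of \<psi> by x remains, which lets x be quantified away at
    the end.\<close>
  moreover have "reindex P h \<chi> \<sqsubseteq>\<^bsub>fibre P (A \<otimes> X)\<^esub> reindex P (Fst C A X) \<psi>"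
    using reindex_le[OF h \<chi>_in reindex_in[OF Fst_Hom[OF A E_Obj] \<psi>_in]
        le_reindex_exists[OF existential projection_Fst[OF A E_Obj] Fst_Hom[OF A E_Obj] \<chi>_in]]
    by (simp add: reindex_Comp[OF h Fst_Hom[OF A E_Obj] \<psi>_in, symmetric] Fst_h)
  ultimately have "\<beta> \<sqsubseteq>\<^bsub>fibre P (A \<otimes> X)\<^esub> reindex P (Fst C A X) \<psi>"
    by (rule fibre_trans[OF AX]) (intro \<beta> reindex_in[OF h \<chi>_in] reindex_in[OF u \<psi>_in])+
  then show ?thesis
    unfolding \<phi>_eq using exists_le_iff[OF existential projection_Fst[OF A X] u \<beta> \<psi>_in] by simp
qed

end

end

theorem proposition3p11:
  fixes \<C> :: "('o, 'a, 'm) cc_category_scheme"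
    and P :: "('o, 'a, 'p) doctrine"
    and A B C :: 'o and \<alpha> :: 'p
  assumes "skolem_doctrine \<C> P"
    and "A \<in> Obj \<C>" and "B \<in> Obj \<C>" and "C \<in> Obj \<C>"
    and "\<alpha> \<in> carrier (fibre P (A \<otimes>\<^bsub>\<C>\<^esub> B \<otimes>\<^bsub>\<C>\<^esub> C))"
  shows "let \<phi> = forall_along \<C> P (Fst \<C> A B) (exists_along \<C> P (Fst \<C> (A \<otimes>\<^bsub>\<C>\<^esub> B) C) \<alpha>);
             \<psi> = exists_along \<C> P (Fst \<C> A (Exp \<C> B C))
                   (forall_along \<C> P (Fst \<C> (A \<otimes>\<^bsub>\<C>\<^esub> Exp \<C> B C) B)
                     (reindex P (skolem_subst \<C> A B C) \<alpha>))
         in \<phi> \<sqsubseteq>\<^bsub>fibre P A\<^esub> \<psi> \<and> \<psi> \<sqsubseteq>\<^bsub>fibre P A\<^esub> \<phi>"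
proof -
  interpret skolem_doctrine \<C> P by fact
  show ?thesis
    unfolding Let_def using skolem_forward skolem_backward assms(2-) by blast
qed

end
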